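(* There is a computable graph $G$ isomorphic to $K^\infty_{<\omega}$ such that for every computable partition of its vertex set $G=X_0\sqcup X_1$, the induced subgraph on $X_0$ or the induced subgraph on $X_1$ is (classically) isomorphic to $K^\infty_{<\omega}$.
   Context: A graph is a set of vertices $V\subseteq\mathbb{N}$ with an irreflexive symmetric edge relation; it is computable if $V$ and the edge relation are computable. $K_n$ denotes the complete graph on $n$ vertices, and $K^\infty_{<\omega}$ denotes the graph that is the disjoint union of infinitely many copies of $K_n$ for each $n\geq 1$ (with no edges between different copies). *)

theory Defs
  imports Main
begin

text \<open>
  Partial recursive functions in the sense of Kleene. \<open>rec_eval f xs y\<close> means that \<open>f\<close>
  converges on the argument tuple \<open>xs\<close> with value \<open>y\<close>. Arities are not part of the syntax:
  on a tuple of unsuitable length a term either ignores arguments or diverges.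
  In \<open>PrimRec\<close> and \<open>Mu\<close> the recursion (resp. search) variable is the first argument.
\<close>

datatype recf =
    Zero
  | Succ
  | Proj nat
  | Comp recf "recf list"
  | PrimRec recf recf
  | Mu recf

inductive rec_eval :: "recf \<Rightarrow> nat list \<Rightarrow> nat \<Rightarrow> bool" where
  eval_Zero: "rec_eval Zero xs 0"
| eval_Succ: "rec_eval Succ [x] (Suc x)"
| eval_Proj: "i < length xs \<Longrightarrow> rec_eval (Proj i) xs (xs ! i)"
| eval_Comp: "list_all2 (\<lambda>g y. rec_eval g xs y) gs ys \<Longrightarrow> rec_eval f ys z
    \<Longrightarrow> rec_eval (Comp f gs) xs z"
| eval_PrimRec_0: "rec_eval f xs y \<Longrightarrow> rec_eval (PrimRec f g) (0 # xs) y"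
| eval_PrimRec_Suc: "rec_eval (PrimRec f g) (n # xs) y \<Longrightarrow> rec_eval g (n # y # xs) z
    \<Longrightarrow> rec_eval (PrimRec f g) (Suc n # xs) z"
| eval_Mu: "rec_eval f (n # xs) 0 \<Longrightarrow> (\<forall>m<n. \<exists>y. rec_eval f (m # xs) (Suc y))
    \<Longrightarrow> rec_eval (Mu f) xs n"

definition computable_set :: "nat set \<Rightarrow> bool" where
  "computable_set A \<longleftrightarrow> (\<exists>f. \<forall>x. rec_eval f [x] (if x \<in> A then 1 else 0))"

definition computable_rel :: "(nat \<times> nat) set \<Rightarrow> bool" where
  "computable_rel R \<longleftrightarrow> (\<exists>f. \<forall>x y. rec_eval f [x, y] (if (x, y) \<in> R then 1 else 0))"

record 'a graph =
  verts :: "'a set"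
  edges :: "('a \<times> 'a) set"

definition is_graph :: "'a graph \<Rightarrow> bool" where
  "is_graph G \<longleftrightarrow> edges G \<subseteq> verts G \<times> verts G \<and> irrefl (edges G) \<and> sym (edges G)"

definition computable_graph :: "nat graph \<Rightarrow> bool" where
  "computable_graph G \<longleftrightarrow> is_graph G \<and> computable_set (verts G) \<and> computable_rel (edges G)"

definition induced_subgraph :: "'a graph \<Rightarrow> 'a set \<Rightarrow> 'a graph" where
  "induced_subgraph G X = \<lparr>verts = verts G \<inter> X, edges = edges G \<inter> X \<times> X\<rparr>"

definition isomorphic :: "'a graph \<Rightarrow> 'b graph \<Rightarrow> bool" where
  "isomorphic G H \<longleftrightarrow> (\<exists>h. bij_betw h (verts G) (verts H) \<and>
     (\<forall>x\<in>verts G. \<forall>y\<in>verts G. (x, y) \<in> edges G \<longleftrightarrow> (h x, h y) \<in> edges H))"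

definition complete_graph :: "nat \<Rightarrow> nat graph" where
  "complete_graph n = \<lparr>verts = {..<n}, edges = {(i, j). i < n \<and> j < n \<and> i \<noteq> j}\<rparr>"

definition disjoint_union :: "'i set \<Rightarrow> ('i \<Rightarrow> 'a graph) \<Rightarrow> ('i \<times> 'a) graph" where
  "disjoint_union I G = \<lparr>verts = (SIGMA i:I. verts (G i)),
     edges = {((i, x), (j, y)). i \<in> I \<and> i = j \<and> (x, y) \<in> edges (G i)}\<rparr>"

text \<open>The index \<open>(n, k)\<close> stands for the \<open>k\<close>-th copy of the complete graph on \<open>n\<close> vertices.\<close>

definition K_inf_fin :: "((nat \<times> nat) \<times> nat) graph" where
  "K_inf_fin = disjoint_union ({1..} \<times> UNIV) (\<lambda>(n, k). complete_graph n)"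

end

theory Submission
  imports Defs "HOL-Library.Nat_Bijection" "HOL-Library.Infinite_Set"
begin

text \<open>
  Every component of the graph is a clique attached to a program \<open>e\<close> and two numbers \<open>a, b\<close>. It
  grows by one vertex at a time, waiting until \<open>e\<close> has decided whether the last vertex lies in \<open>X0\<close>,
  and stops as soon as \<open>a\<close> of its vertices are in \<open>X0\<close> or \<open>b\<close> of them are in \<open>X1\<close>. So all cliques
  are finite, and if \<open>e\<close> decides \<open>X0\<close> then the clique meets \<open>X0\<close> in exactly \<open>a\<close> or \<open>X1\<close> in exactly \<open>b\<close>
  vertices. As each triple is treated infinitely often, it is impossible that \<open>X0\<close> has only
  finitely many cliques of some size \<open>a\<close> and \<open>X1\<close> only finitely many of some size \<open>b\<close>. That the
  graph itself has the right isomorphism type is the case \<open>X1 = {}\<close>.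
\<close>

section \<open>Closure properties of recursive functions\<close>

text \<open>The arity \<open>n\<close> is explicit because terms carry none; on tuples of other
  lengths \<open>F\<close> is unconstrained. Speaking about \<open>F\<close> instead of a term lets
  computability be derived by introduction rules that follow the shape of an expression.\<close>

definition recursive :: "nat \<Rightarrow> (nat list \<Rightarrow> nat) \<Rightarrow> bool" where
  "recursive n F \<longleftrightarrow> (\<exists>r. \<forall>xs. length xs = n \<longrightarrow> rec_eval r xs (F xs))"

lemma recursive_cong:
  assumes "recursive n F" and "\<And>xs. length xs = n \<Longrightarrow> F xs = G xs"
  shows "recursive n G"
  using assms unfolding recursive_def by metis

lemma recursive_nth: "i < n \<Longrightarrow> recursive n (\<lambda>xs. xs ! i)"
  unfolding recursive_def using eval_Proj by blast

lemma recursive_comp: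
  assumes "recursive (length Fs) G" and "\<forall>F\<in>set Fs. recursive n F"
  shows "recursive n (\<lambda>xs. G (map (\<lambda>F. F xs) Fs))"
proof -
  obtain g where g: "\<And>ys. length ys = length Fs \<Longrightarrow> rec_eval g ys (G ys)"
    using assms(1) unfolding recursive_def by blast
  obtain c where c: "\<And>F xs. F \<in> set Fs \<Longrightarrow> length xs = n \<Longrightarrow> rec_eval (c F) xs (F xs)"
    using assms(2) unfolding recursive_def by metis
  have "rec_eval (Comp g (map c Fs)) xs (G (map (\<lambda>F. F xs) Fs))" if "length xs = n" for xs
    using that c by (intro eval_Comp[OF _ g])
      (auto simp: list_all2_conv_all_nth)
  then show ?thesis unfolding recursive_def by blast
qed

text \<open>With this rule and its analogues it suffices to treat an operation on projections; it
  then applies to arbitrary recursive subexpressions.\<close>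

lemma recursive_subst1:
  assumes "recursive 1 (\<lambda>xs. g (xs ! 0))" and "recursive n F"
  shows "recursive n (\<lambda>xs. g (F xs))"
  using recursive_comp[of "[F]" "\<lambda>xs. g (xs ! 0)" n] assms by simp

lemma recursive_subst2:
  assumes "recursive 2 (\<lambda>xs. g (xs ! 0) (xs ! 1))" and "recursive n F" and "recursive n G"
  shows "recursive n (\<lambda>xs. g (F xs) (G xs))"
  using recursive_comp[of "[F, G]" "\<lambda>xs. g (xs ! 0) (xs ! 1)" n] assms
  by (simp add: numeral_2_eq_2)

lemma recursive_subst3:
  assumes "recursive 3 (\<lambda>xs. g (xs ! 0) (xs ! 1) (xs ! 2))"
    and "recursive n F" and "recursive n G" and "recursive n H"
  shows "recursive n (\<lambda>xs. g (F xs) (G xs) (H xs))"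
  using recursive_comp[of "[F, G, H]" "\<lambda>xs. g (xs ! 0) (xs ! 1) (xs ! 2)" n] assms
  by (simp add: numeral_2_eq_2 numeral_3_eq_3)

lemma recursive_Suc: "recursive n F \<Longrightarrow> recursive n (\<lambda>xs. Suc (F xs))"
proof (rule recursive_subst1[where g = Suc])
  have "rec_eval Succ xs (Suc (xs ! 0))" if "length xs = 1" for xs
    using that eval_Succ by (cases xs) auto
  then show "recursive 1 (\<lambda>xs. Suc (xs ! 0))" unfolding recursive_def by blast
qed

lemma recursive_const: "recursive n (\<lambda>xs. c)"
proof (induction c)
  case 0
  then show ?case unfolding recursive_def using eval_Zero by blast
qed (rule recursive_Suc)

lemma recursive_primrec:
  assumes "recursive n F" and "recursive (Suc (Suc n)) G"
    and H0: "\<And>xs. length xs = n \<Longrightarrow> H (0 # xs) = F xs"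
    and HS: "\<And>m xs. length xs = n \<Longrightarrow> H (Suc m # xs) = G (m # H (m # xs) # xs)"
  shows "recursive (Suc n) H"
proof -
  obtain f where f: "\<And>xs. length xs = n \<Longrightarrow> rec_eval f xs (F xs)"
    using assms(1) unfolding recursive_def by blast
  obtain g where g: "\<And>xs. length xs = Suc (Suc n) \<Longrightarrow> rec_eval g xs (G xs)"
    using assms(2) unfolding recursive_def by blast
  have "rec_eval (PrimRec f g) (m # xs) (H (m # xs))" if "length xs = n" for m xs
  proof (induction m)
    case 0
    then show ?case using that f H0 by (simp add: eval_PrimRec_0)
  next
    case (Suc m)
    then show ?case using that g by (auto simp: HS intro: eval_PrimRec_Suc)
  qed
  then have "rec_eval (PrimRec f g) xs (H xs)" if "length xs = Suc n" for xs
    using that by (cases xs) auto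
  then show ?thesis unfolding recursive_def by blast
qed

lemma recursive_Least:
  assumes "recursive (Suc n) F" and ex: "\<And>xs. length xs = n \<Longrightarrow> \<exists>m. F (m # xs) = 0"
  shows "recursive n (\<lambda>xs. LEAST m. F (m # xs) = 0)"
proof -
  obtain f where f: "\<And>xs. length xs = Suc n \<Longrightarrow> rec_eval f xs (F xs)"
    using assms(1) unfolding recursive_def by blast
  have "rec_eval (Mu f) xs (LEAST m. F (m # xs) = 0)" if len: "length xs = n" for xs
  proof (rule eval_Mu)
    show "rec_eval f ((LEAST m. F (m # xs) = 0) # xs) 0"
      using f[of "(LEAST m. F (m # xs) = 0) # xs"] LeastI_ex[OF ex[OF len]] len by simp
    show "\<forall>m<LEAST m. F (m # xs) = 0. \<exists>y. rec_eval f (m # xs) (Suc y)"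
      using f[of "_ # xs"] len by (metis length_Cons not_less_Least old.nat.exhaust)
  qed
  then show ?thesis unfolding recursive_def by blast
qed

lemma recursive_pred: "recursive n F \<Longrightarrow> recursive n (\<lambda>xs. F xs - 1)"
proof (rule recursive_subst1[where g = "\<lambda>x. x - 1"])
  show "recursive 1 (\<lambda>xs. xs ! 0 - 1)"
    unfolding One_nat_def
    by (rule recursive_primrec[OF recursive_const[of _ 0] recursive_nth[of 0]]) auto
qed

lemma recursive_add:
  "recursive n F \<Longrightarrow> recursive n G \<Longrightarrow> recursive n (\<lambda>xs. F xs + G xs)"
proof (rule recursive_subst2[where g = "(+)"])
  show "recursive 2 (\<lambda>xs. xs ! 0 + xs ! 1)"
    unfolding numeral_2_eq_2
    by (rule recursive_primrec[OF recursive_nth[of 0] recursive_Suc[OF recursive_nth[of 1]]]) auto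
qed

lemma recursive_diff:
  "recursive n F \<Longrightarrow> recursive n G \<Longrightarrow> recursive n (\<lambda>xs. F xs - G xs)"
\<comment> \<open>Recursion runs over the first argument, so the subtrahend is put there: each round
  takes one more predecessor.\<close>
proof (rule recursive_subst2[where g = "\<lambda>x y. y - x"])
  show "recursive 2 (\<lambda>xs. xs ! 1 - xs ! 0)"
    unfolding numeral_2_eq_2
    by (rule recursive_primrec[OF recursive_nth[of 0] recursive_pred[OF recursive_nth[of 1]]]) auto
qed

lemma recursive_if_eq:
  assumes "recursive n F" and "recursive n G" and "recursive n A" and "recursive n B"
  shows "recursive n (\<lambda>xs. if F xs = G xs then A xs else B xs)"
proof -
  \<comment> \<open>A zero test is a primitive recursion whose step discards the previous value;
    index 3 is the else branch, behind the counter, that value and the then branch.\<close>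
  have "recursive 3 (\<lambda>xs. if xs ! 0 = 0 then xs ! 1 else xs ! 2)"
    unfolding numeral_3_eq_3
    by (rule recursive_primrec[OF recursive_nth[of 0] recursive_nth[of 3]]) auto
  \<comment> \<open>With truncated subtraction, the sum of both differences vanishes exactly when
    the arguments are equal.\<close>
  then have "recursive n (\<lambda>xs. if (F xs - G xs) + (G xs - F xs) = 0 then A xs else B xs)"
    by (rule recursive_subst3[where g = "\<lambda>x y z. if x = 0 then y else z"])
      (intro recursive_add recursive_diff assms)+
  then show ?thesis by (rule recursive_cong) auto
qed

lemma recursive_triangle: "recursive n F \<Longrightarrow> recursive n (\<lambda>xs. triangle (F xs))"
proof (rule recursive_subst1[where g = triangle])
  show "recursive 1 (\<lambda>xs. triangle (xs ! 0))"
    unfolding One_nat_def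
    by (rule recursive_primrec[OF recursive_const[of _ 0]
          recursive_add[OF recursive_nth[of 1] recursive_Suc[OF recursive_nth[of 0]]]]) auto
qed

section \<open>Cantor pairing and its inverses\<close>

abbreviation pair :: "nat \<Rightarrow> nat \<Rightarrow> nat" ("\<langle>_,/ _\<rangle>") where
  "\<langle>a, b\<rangle> \<equiv> prod_encode (a, b)"

definition p1 :: "nat \<Rightarrow> nat" where "p1 z = fst (prod_decode z)"

definition p2 :: "nat \<Rightarrow> nat" where "p2 z = snd (prod_decode z)"

lemma p1_pair [simp]: "p1 \<langle>a, b\<rangle> = a" and p2_pair [simp]: "p2 \<langle>a, b\<rangle> = b"
  by (simp_all add: p1_def p2_def)

lemma pair_p1_p2 [simp]: "\<langle>p1 z, p2 z\<rangle> = z"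
  by (simp add: p1_def p2_def)

lemma triangle_mono: "i \<le> j \<Longrightarrow> triangle i \<le> triangle j"
  by (rule lift_Suc_mono_le[of triangle]) auto

text \<open>The code of \<open>(a, b)\<close> is \<open>triangle (a + b) + a\<close>, which lies
  below \<open>triangle (Suc (a + b))\<close>. So a search for the first triangle number above
  \<open>z\<close> finds the diagonal \<open>a + b\<close>, from which both components follow by
  subtraction.\<close>

lemma Least_triangle: "(LEAST k. Suc z - triangle (Suc k) = 0) = p1 z + p2 z"
proof (rule Least_equality)
  obtain a b where z: "z = \<langle>a, b\<rangle>" by (metis pair_p1_p2)
  show "Suc z - triangle (Suc (p1 z + p2 z)) = 0"
    by (simp add: z) (simp add: prod_encode_def)
  fix k assume "Suc z - triangle (Suc k) = 0"
  then have "triangle (a + b) < triangle (Suc k)" by (simp add: z prod_encode_def)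
  then have "a + b < Suc k" using triangle_mono by (meson not_less)
  then show "p1 z + p2 z \<le> k" by (simp add: z)
qed

lemma recursive_p1_add_p2: "recursive n F \<Longrightarrow> recursive n (\<lambda>xs. p1 (F xs) + p2 (F xs))"
proof (rule recursive_subst1[where g = "\<lambda>z. p1 z + p2 z"])
  have "recursive (Suc 1) (\<lambda>xs. Suc (xs ! 1) - triangle (Suc (xs ! 0)))"
    by (intro recursive_diff recursive_Suc recursive_triangle recursive_nth) auto
  moreover have "\<exists>m. Suc (xs ! 0) - triangle (Suc m) = 0" for xs :: "nat list"
    by (rule exI[of _ "xs ! 0"]) simp
  ultimately have "recursive 1 (\<lambda>xs. LEAST m. Suc (xs ! 0) - triangle (Suc m) = 0)"
    using recursive_Least[of 1 "\<lambda>xs. Suc (xs ! 1) - triangle (Suc (xs ! 0))"] by simp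
  then show "recursive 1 (\<lambda>xs. p1 (xs ! 0) + p2 (xs ! 0))"
    unfolding Least_triangle .
qed

lemma recursive_p1:
  assumes "recursive n F"
  shows "recursive n (\<lambda>xs. p1 (F xs))"
proof -
  have "recursive n (\<lambda>xs. F xs - triangle (p1 (F xs) + p2 (F xs)))"
    by (intro recursive_diff recursive_triangle recursive_p1_add_p2 assms)
  moreover have "z - triangle (p1 z + p2 z) = p1 z" for z
    by (subst pair_p1_p2[of z, symmetric], unfold prod_encode_def) simp
  ultimately show ?thesis by simp
qed

lemma recursive_p2:
  assumes "recursive n F"
  shows "recursive n (\<lambda>xs. p2 (F xs))"
proof -
  have "recursive n (\<lambda>xs. p1 (F xs) + p2 (F xs) - p1 (F xs))"
    by (intro recursive_diff recursive_p1_add_p2 recursive_p1 assms)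
  then show ?thesis by simp
qed

lemma recursive_pair:
  "recursive n F \<Longrightarrow> recursive n G \<Longrightarrow> recursive n (\<lambda>xs. \<langle>F xs, G xs\<rangle>)"
  unfolding prod_encode_def prod.case
  by (intro recursive_add recursive_triangle)

lemmas recursive_intros =
  recursive_const recursive_nth recursive_Suc recursive_pred recursive_if_eq
  recursive_p1 recursive_p2 recursive_pair

lemma computable_setI:
  assumes "recursive 1 (\<lambda>xs. if xs ! 0 \<in> A then 1 else 0)"
  shows "computable_set A"
proof -
  obtain r where r: "\<And>xs. length xs = 1 \<Longrightarrow> rec_eval r xs (if xs ! 0 \<in> A then 1 else 0)"
    using assms unfolding recursive_def by blast
  have "rec_eval r [x] (if x \<in> A then 1 else 0)" for x
    using r[of "[x]"] by simp
  then show ?thesis unfolding computable_set_def by blast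
qed

lemma computable_relI:
  assumes "recursive 2 (\<lambda>xs. if (xs ! 0, xs ! 1) \<in> R then 1 else 0)"
  shows "computable_rel R"
proof -
  obtain r where r: "\<And>xs. length xs = 2 \<Longrightarrow>
      rec_eval r xs (if (xs ! 0, xs ! 1) \<in> R then 1 else 0)"
    using assms unfolding recursive_def by blast
  have "rec_eval r [x, y] (if (x, y) \<in> R then 1 else 0)" for x y
    using r[of "[x, y]"] by simp
  then show ?thesis unfolding computable_rel_def by blast
qed

section \<open>A universal abstract machine\<close>

text \<open>
  Terms are coded as pairs of a tag and arguments. The third component of a composition holds
  the argument values computed so far (hence the reversed list), the second one of a minimisation
  the current candidate; so a suspended term together with its argument tuple serves as
  a stack frame.
\<close>

fun code :: "recf \<Rightarrow> nat" where
  "code Zero = \<langle>0, 0\<rangle>"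
| "code Succ = \<langle>1, 0\<rangle>"
| "code (Proj i) = \<langle>2, i\<rangle>"
| "code (Comp f gs) = \<langle>3, \<langle>code f, \<langle>list_encode (rev (map code gs)), 0\<rangle>\<rangle>\<rangle>"
| "code (PrimRec f g) = \<langle>4, \<langle>code f, code g\<rangle>\<rangle>"
| "code (Mu f) = \<langle>5, \<langle>code f, 0\<rangle>\<rangle>"

text \<open>Agrees with \<open>list_encode\<close>, so 0 is the empty list. Argument tuples and the
  stack share this coding.\<close>

definition cons :: "nat \<Rightarrow> nat \<Rightarrow> nat" where "cons x l = Suc \<langle>x, l\<rangle>"

definition head :: "nat \<Rightarrow> nat" where "head l = p1 (l - 1)"

definition tail :: "nat \<Rightarrow> nat" where "tail l = p2 (l - 1)"

text \<open>The two kinds of machine state, told apart by a zero first component: evaluate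
  \<open>c\<close> on \<open>l\<close> above the stack \<open>k\<close>, or hand the value
  \<open>y\<close> to the stack \<open>k\<close>.\<close>

definition Run :: "nat \<Rightarrow> nat \<Rightarrow> nat \<Rightarrow> nat" where "Run c l k = \<langle>Suc c, \<langle>l, k\<rangle>\<rangle>"

definition Ret :: "nat \<Rightarrow> nat \<Rightarrow> nat" where "Ret y k = \<langle>0, \<langle>y, k\<rangle>\<rangle>"

lemma head_cons [simp]: "head (cons x l) = x"
  and tail_cons [simp]: "tail (cons x l) = l"
  and cons_neq_0 [simp]: "cons x l \<noteq> 0"
  by (simp_all add: head_def tail_def cons_def)

text \<open>No clause recurses over terms: a projection drops one argument per step, and other work
  is deferred by pushing the current call. Hence the closure rules apply directly.\<close>

definition step_run :: "nat \<Rightarrow> nat \<Rightarrow> nat \<Rightarrow> nat" where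
  "step_run c l k =
    (if p1 c = 0 then Ret 0 k
     else if p1 c = 1 then Ret (Suc (head l)) k
     else if p1 c = 2 then
       (if p2 c = 0 then Ret (head l) k else Run \<langle>2, p2 c - 1\<rangle> (tail l) k)
     else if p1 c = 3 then
       (if p1 (p2 (p2 c)) = 0 then Run (p1 (p2 c)) (p2 (p2 (p2 c))) k
        else Run (head (p1 (p2 (p2 c)))) l (cons \<langle>c, l\<rangle> k))
     else if p1 c = 4 then
       (if head l = 0 then Run (p1 (p2 c)) (tail l) k
        else Run c (cons (head l - 1) (tail l)) (cons \<langle>c, l\<rangle> k))
     else Run (p1 (p2 c)) (cons (p2 (p2 c)) l) (cons \<langle>c, l\<rangle> k))"

definition step_ret :: "nat \<Rightarrow> nat \<Rightarrow> nat \<Rightarrow> nat \<Rightarrow> nat" where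
  "step_ret y c l k =
    (if p1 c = 3 then
       Run \<langle>3, \<langle>p1 (p2 c), \<langle>tail (p1 (p2 (p2 c))), cons y (p2 (p2 (p2 c)))\<rangle>\<rangle>\<rangle> l k
     else if p1 c = 4 then Run (p2 (p2 c)) (cons (head l - 1) (cons y (tail l))) k
     else if y = 0 then Ret (p2 (p2 c)) k
     else Run \<langle>5, \<langle>p1 (p2 c), Suc (p2 (p2 c))\<rangle>\<rangle> l k)"

text \<open>A returned value above the empty stack is a fixed point, which makes halting
  recognisable from the state.\<close>

definition step :: "nat \<Rightarrow> nat" where
  "step s =
    (if p1 s = 0 then
       if p2 (p2 s) = 0 then s
       else step_ret (p1 (p2 s)) (p1 (head (p2 (p2 s)))) (p2 (head (p2 (p2 s)))) (tail (p2 (p2 s)))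
     else step_run (p1 s - 1) (p1 (p2 s)) (p2 (p2 s)))"

lemma step_Run: "step (Run c l k) = step_run c l k"
  by (simp add: step_def Run_def)

lemma step_Ret: "step (Ret y (cons \<langle>c, l\<rangle> k)) = step_ret y c l k"
  by (simp add: step_def Ret_def)

section \<open>Simulation of converging computations by the machine\<close>

abbreviation steps :: "nat \<Rightarrow> nat \<Rightarrow> bool" (infix "\<leadsto>" 50) where
  "s \<leadsto> t \<equiv> (\<lambda>s t. t = step s)\<^sup>*\<^sup>* s t"

lemma steps_Suc: "step s \<leadsto> t \<Longrightarrow> s \<leadsto> t"
  by (rule converse_rtranclp_into_rtranclp) auto

lemma steps_trans: "s \<leadsto> t \<Longrightarrow> t \<leadsto> u \<Longrightarrow> s \<leadsto> u"
  by (rule rtranclp_trans)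

lemma steps_RunI: "step_run c l k \<leadsto> t \<Longrightarrow> Run c l k \<leadsto> t"
  by (rule steps_Suc) (simp add: step_Run)

lemma steps_RetI: "step_ret y c l k \<leadsto> t \<Longrightarrow> Ret y (cons \<langle>c, l\<rangle> k) \<leadsto> t"
  by (rule steps_Suc) (simp add: step_Ret)

lemma list_encode_Cons [simp]: "list_encode (x # xs) = cons x (list_encode xs)"
  by (simp add: cons_def)

declare list_encode.simps(2) [simp del]

lemma steps_Proj:
  "i < length xs \<Longrightarrow> Run \<langle>2, i\<rangle> (list_encode xs) k \<leadsto> Ret (xs ! i) k"
proof (induction i arbitrary: xs)
  case 0
  then show ?case by (cases xs) (auto intro!: steps_RunI simp: step_run_def)
next
  case (Suc i)
  then show ?case by (cases xs) (auto intro!: steps_RunI simp: step_run_def)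
qed

text \<open>Each value is put in front of \<open>acc\<close>, so the values end up in the reverse of
  the order of evaluation. As \<open>code\<close> stores the argument terms reversed,
  \<open>foldl_cons_rev\<close> restores the right order.\<close>

lemma steps_args:
  assumes "list_all2 (\<lambda>g y. \<forall>k. Run (code g) l k \<leadsto> Ret y k) gs ys"
  shows "Run \<langle>3, \<langle>c, \<langle>list_encode (map code gs), acc\<rangle>\<rangle>\<rangle> l k
    \<leadsto> Run c (foldl (\<lambda>a y. cons y a) acc ys) k"
  using assms
proof (induction gs ys arbitrary: acc rule: list_all2_induct)
  case Nil
  show ?case by (rule steps_RunI) (simp add: step_run_def)
next
  case (Cons g gs y ys)
  let ?c = "\<langle>3, \<langle>c, \<langle>list_encode (map code (g # gs)), acc\<rangle>\<rangle>\<rangle>"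
  have "Run ?c l k \<leadsto> Ret y (cons \<langle>?c, l\<rangle> k)"
    using Cons(1) by (intro steps_RunI) (simp add: step_run_def)
  moreover have "Ret y (cons \<langle>?c, l\<rangle> k)
      \<leadsto> Run \<langle>3, \<langle>c, \<langle>list_encode (map code gs), cons y acc\<rangle>\<rangle>\<rangle> l k"
    by (rule steps_RetI) (simp add: step_ret_def)
  ultimately show ?case
    using Cons(3)[of "cons y acc"] by (auto intro: steps_trans)
qed

lemma foldl_cons_rev: "foldl (\<lambda>a y. cons y a) 0 (rev ys) = list_encode ys"
  by (induction ys) auto

text \<open>The search may start at any candidate \<open>m\<close> up to \<open>n\<close>, and the
  induction runs downwards from \<open>n\<close>: at \<open>n\<close> the search succeeds, below it
  a positive value moves on to the next candidate.\<close>

lemma steps_Mu: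
  assumes "\<forall>k. Run c (cons n l) k \<leadsto> Ret 0 k"
    and "\<forall>i<n. \<exists>y. \<forall>k. Run c (cons i l) k \<leadsto> Ret (Suc y) k"
    and "m \<le> n"
  shows "Run \<langle>5, \<langle>c, m\<rangle>\<rangle> l k \<leadsto> Ret n k"
  using \<open>m \<le> n\<close>
proof (induction m rule: inc_induct)
  case base
  have "Run \<langle>5, \<langle>c, n\<rangle>\<rangle> l k \<leadsto> Ret 0 (cons \<langle>\<langle>5, \<langle>c, n\<rangle>\<rangle>, l\<rangle> k)"
    using assms(1) by (intro steps_RunI) (simp add: step_run_def)
  moreover have "Ret 0 (cons \<langle>\<langle>5, \<langle>c, n\<rangle>\<rangle>, l\<rangle> k) \<leadsto> Ret n k"
    by (rule steps_RetI) (simp add: step_ret_def)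
  ultimately show ?case by (rule steps_trans)
next
  case (step m)
  obtain y where "\<forall>k. Run c (cons m l) k \<leadsto> Ret (Suc y) k" using step assms(2) by blast
  then have "Run \<langle>5, \<langle>c, m\<rangle>\<rangle> l k \<leadsto> Ret (Suc y) (cons \<langle>\<langle>5, \<langle>c, m\<rangle>\<rangle>, l\<rangle> k)"
    by (intro steps_RunI) (simp add: step_run_def)
  moreover have "Ret (Suc y) (cons \<langle>\<langle>5, \<langle>c, m\<rangle>\<rangle>, l\<rangle> k) \<leadsto> Ret n k"
    using step by (intro steps_RetI) (simp add: step_ret_def)
  ultimately show ?case by (rule steps_trans)
qed

text \<open>Induction on the evaluation, for all stacks \<open>k\<close> at once, since a
  subcomputation runs above the frame pushed by its caller.\<close>

theorem steps_complete:
  "rec_eval f xs y \<Longrightarrow> Run (code f) (list_encode xs) k \<leadsto> Ret y k"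
proof (induction arbitrary: k rule: rec_eval.induct)
  case (eval_Zero xs)
  show ?case by (rule steps_RunI) (simp add: step_run_def)
next
  case (eval_Succ x)
  show ?case by (rule steps_RunI) (simp add: step_run_def)
next
  case (eval_Proj i xs)
  then show ?case by (simp add: steps_Proj)
next
  case (eval_Comp xs gs ys f z)
  from eval_Comp.IH(1)
  have "list_all2 (\<lambda>g y. \<forall>k. Run (code g) (list_encode xs) k \<leadsto> Ret y k) (rev gs) (rev ys)"
    by (auto elim: list_all2_mono)
  from steps_args[OF this, of "code f" 0 k]
  have "Run (code (Comp f gs)) (list_encode xs) k \<leadsto> Run (code f) (list_encode ys) k"
    by (simp add: foldl_cons_rev rev_map)
  with eval_Comp.IH(2) show ?case by (blast intro: steps_trans)
next
  case (eval_PrimRec_0 f xs y g)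
  then show ?case by (intro steps_RunI) (simp add: step_run_def)
next
  case (eval_PrimRec_Suc f g n xs y z)
  let ?c = "code (PrimRec f g)" and ?l = "list_encode (Suc n # xs)"
  have "Run ?c ?l k \<leadsto> Ret y (cons \<langle>?c, ?l\<rangle> k)"
    using eval_PrimRec_Suc.IH(1)[of "cons \<langle>?c, ?l\<rangle> k"]
    by (intro steps_RunI) (simp add: step_run_def)
  moreover have "Ret y (cons \<langle>?c, ?l\<rangle> k) \<leadsto> Ret z k"
    using eval_PrimRec_Suc.IH(2) by (intro steps_RetI) (simp add: step_ret_def)
  ultimately show ?case by (rule steps_trans)
next
  case (eval_Mu f n xs)
  have "\<exists>y. \<forall>k. Run (code f) (cons i (list_encode xs)) k \<leadsto> Ret (Suc y) k"
    if "i < n" for i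
  proof -
    from eval_Mu.IH(2) that obtain y where
      "\<And>k. Run (code f) (list_encode (i # xs)) k \<leadsto> Ret (Suc y) k" by blast
    then show ?thesis unfolding list_encode_Cons by blast
  qed
  then show ?case using eval_Mu.IH(1) by (simp add: steps_Mu)
qed

section \<open>Recursiveness of the step function\<close>

lemma recursive_Run:
  "recursive n C \<Longrightarrow> recursive n L \<Longrightarrow> recursive n K
    \<Longrightarrow> recursive n (\<lambda>xs. Run (C xs) (L xs) (K xs))"
  unfolding Run_def by (intro recursive_intros)

lemma recursive_Ret:
  "recursive n Y \<Longrightarrow> recursive n K \<Longrightarrow> recursive n (\<lambda>xs. Ret (Y xs) (K xs))"
  unfolding Ret_def by (intro recursive_intros)

lemma recursive_cons:
  "recursive n X \<Longrightarrow> recursive n L \<Longrightarrow> recursive n (\<lambda>xs. cons (X xs) (L xs))"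
  unfolding cons_def by (intro recursive_intros)

lemma recursive_head: "recursive n L \<Longrightarrow> recursive n (\<lambda>xs. head (L xs))"
  unfolding head_def by (intro recursive_intros)

lemma recursive_tail: "recursive n L \<Longrightarrow> recursive n (\<lambda>xs. tail (L xs))"
  unfolding tail_def by (intro recursive_intros)

lemmas recursive_machine_intros =
  recursive_intros recursive_Run recursive_Ret recursive_cons recursive_head recursive_tail

lemma recursive_step_run:
  "recursive n C \<Longrightarrow> recursive n L \<Longrightarrow> recursive n K
    \<Longrightarrow> recursive n (\<lambda>xs. step_run (C xs) (L xs) (K xs))"
  unfolding step_run_def by (intro recursive_machine_intros)

lemma recursive_step_ret:
  "recursive n Y \<Longrightarrow> recursive n C \<Longrightarrow> recursive n L \<Longrightarrow> recursive n K
    \<Longrightarrow> recursive n (\<lambda>xs. step_ret (Y xs) (C xs) (L xs) (K xs))"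
  unfolding step_ret_def by (intro recursive_machine_intros)

lemma recursive_step: "recursive n F \<Longrightarrow> recursive n (\<lambda>xs. step (F xs))"
  unfolding step_def
  by (intro recursive_machine_intros recursive_step_run recursive_step_ret)

section \<open>Disjoint unions of cliques\<close>

text \<open>The label \<open>\<kappa>\<close> names the component of a vertex. Induced subgraphs
  keep this form, so only the sizes of the fibres of \<open>\<kappa>\<close> matter.\<close>

definition clique_graph :: "('a \<Rightarrow> nat) \<Rightarrow> 'a set \<Rightarrow> 'a graph" where
  "clique_graph \<kappa> V =
    \<lparr>verts = V, edges = {(u, v). u \<in> V \<and> v \<in> V \<and> \<kappa> u = \<kappa> v \<and> u \<noteq> v}\<rparr>"

lemma is_graph_clique_graph: "is_graph (clique_graph \<kappa> V)"
  by (auto simp: is_graph_def clique_graph_def irrefl_def sym_def)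

lemma induced_subgraph_clique_graph:
  "X \<subseteq> V \<Longrightarrow> induced_subgraph (clique_graph \<kappa> V) X = clique_graph \<kappa> X"
  by (auto simp: induced_subgraph_def clique_graph_def)

abbreviation clique :: "('a \<Rightarrow> nat) \<Rightarrow> 'a set \<Rightarrow> nat \<Rightarrow> 'a set" where
  "clique \<kappa> V r \<equiv> {v \<in> V. \<kappa> v = r}"

text \<open>For each \<open>n \<ge> 1\<close> the infinitely many labels of cliques of size
  \<open>n\<close> are numbered by \<open>g n\<close>, and the vertices of clique \<open>r\<close>
  by \<open>h r\<close>. A vertex is sent to the size of its clique, the number of that clique and
  its own number.\<close>

lemma isomorphic_K_inf_fin:
  assumes fin: "\<And>r. finite (clique \<kappa> V r)"
    and inf: "\<And>n. n \<ge> 1 \<Longrightarrow> infinite {r. card (clique \<kappa> V r) = n}"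
  shows "isomorphic (clique_graph \<kappa> V) K_inf_fin"
proof -
  let ?c = "\<lambda>r. card (clique \<kappa> V r)"
  have "\<exists>g. bij_betw g {r. ?c r = n} (UNIV :: nat set)" if "n \<ge> 1" for n
    using bij_betw_inv_into[OF bij_enumerate[OF inf[OF that]]] by blast
  then obtain g where g: "\<And>n. n \<ge> 1 \<Longrightarrow> bij_betw (g n) {r. ?c r = n} (UNIV :: nat set)"
    by metis
  obtain h where h: "\<And>r. bij_betw (h r) (clique \<kappa> V r) {0..<?c r}"
    using ex_bij_betw_finite_nat[OF fin] by metis
  define \<phi> where "\<phi> v = ((?c (\<kappa> v), g (?c (\<kappa> v)) (\<kappa> v)), h (\<kappa> v) v)" for v
  have pos: "?c (\<kappa> v) \<ge> 1" if "v \<in> V" for v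
    using that fin[of "\<kappa> v"] by (auto simp: Suc_le_eq card_gt_0_iff)
  have mem: "h (\<kappa> v) v < ?c (\<kappa> v)" if "v \<in> V" for v
    using bij_betwE[OF h[of "\<kappa> v"]] that by auto
  \<comment> \<open>Equal first components mean equal clique sizes \<open>n\<close> and equal values
    of \<open>g n\<close>, which is injective on the labels of size \<open>n\<close>.\<close>
  have key: "\<kappa> u = \<kappa> v" if uv: "u \<in> V" "v \<in> V" "fst (\<phi> u) = fst (\<phi> v)" for u v
  proof (rule inj_onD[OF bij_betw_imp_inj_on[OF g[OF pos[OF uv(1)]]]])
    have "?c (\<kappa> u) = ?c (\<kappa> v)" using uv(3) by (simp add: \<phi>_def)
    moreover from this show "g (?c (\<kappa> u)) (\<kappa> u) = g (?c (\<kappa> u)) (\<kappa> v)"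
      using uv(3) unfolding \<phi>_def by simp
    ultimately show "\<kappa> u \<in> {r. ?c r = ?c (\<kappa> u)}" "\<kappa> v \<in> {r. ?c r = ?c (\<kappa> u)}"
      by simp_all
  qed
  have "inj_on \<phi> V"
  proof (rule inj_onI)
    fix u v assume uv: "u \<in> V" "v \<in> V" "\<phi> u = \<phi> v"
    have "\<kappa> u = \<kappa> v" using key[OF uv(1,2)] uv(3) by simp
    moreover from this have "h (\<kappa> u) u = h (\<kappa> u) v"
      using uv(3) by (simp add: \<phi>_def)
    ultimately show "u = v"
      using uv(1,2) inj_onD[OF bij_betw_imp_inj_on[OF h], of "\<kappa> u" u v] by simp
  qed
  moreover have "\<phi> ` V = verts K_inf_fin"
  proof
    show "\<phi> ` V \<subseteq> verts K_inf_fin"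
      using pos mem by (auto simp: \<phi>_def K_inf_fin_def disjoint_union_def complete_graph_def)
  next
    show "verts K_inf_fin \<subseteq> \<phi> ` V"
    proof
      fix p :: "(nat \<times> nat) \<times> nat" assume "p \<in> verts K_inf_fin"
      then obtain n k i where p: "p = ((n, k), i)" and n: "n \<ge> 1" and i: "i < n"
        by (auto simp: K_inf_fin_def disjoint_union_def complete_graph_def)
      have "k \<in> g n ` {r. ?c r = n}" using bij_betw_imp_surj_on[OF g[OF n]] by simp
      then obtain r where r: "?c r = n" "g n r = k" by blast
      have "i \<in> h r ` clique \<kappa> V r"
        using bij_betw_imp_surj_on[OF h[of r]] i r(1) by simp
      then obtain v where "v \<in> V" "\<kappa> v = r" "h r v = i" by blast
      then show "p \<in> \<phi> ` V" using r by (auto simp: p \<phi>_def)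
    qed
  qed
  moreover have "(\<phi> u, \<phi> v) \<in> edges K_inf_fin \<longleftrightarrow> \<kappa> u = \<kappa> v \<and> u \<noteq> v"
    if "u \<in> V" "v \<in> V" for u v
  proof -
    have "(\<phi> u, \<phi> v) \<in> edges K_inf_fin \<longleftrightarrow> fst (\<phi> u) = fst (\<phi> v) \<and> snd (\<phi> u) \<noteq> snd (\<phi> v)"
      using mem[OF that(1)] mem[OF that(2)] pos[OF that(1)] pos[OF that(2)]
      by (auto simp: \<phi>_def K_inf_fin_def disjoint_union_def complete_graph_def)
    also have "\<dots> \<longleftrightarrow> \<kappa> u = \<kappa> v \<and> \<phi> u \<noteq> \<phi> v"
      using key[OF that] by (auto simp: prod_eq_iff) (auto simp: \<phi>_def)
    also have "\<dots> \<longleftrightarrow> \<kappa> u = \<kappa> v \<and> u \<noteq> v"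
      using inj_onD[OF \<open>inj_on \<phi> V\<close> _ that] by blast
    finally show ?thesis .
  qed
  ultimately show ?thesis
    unfolding isomorphic_def bij_betw_def
    by (intro exI[of _ \<phi>]) (simp add: clique_graph_def)
qed

section \<open>The diagonalising graph\<close>

text \<open>A vanishing sum says both that a value is being returned and that the stack is empty; a
  single equation fits \<open>recursive_if_eq\<close>.\<close>

definition halted :: "nat \<Rightarrow> bool" where "halted m \<longleftrightarrow> p1 m + p2 (p2 m) = 0"

text \<open>
  Component \<open>r = \<langle>e, \<langle>a, \<langle>b, k\<rangle>\<rangle>\<rangle>\<close> is built in stages. Its state consists of the number of
  vertices still wanted in \<open>X0\<close>, the number still wanted in \<open>X1\<close>, and either \<open>0\<close> (a new vertex is
  requested) or \<open>Suc m\<close>, where \<open>m\<close> is the state of machine \<open>e\<close> run on the latest vertex.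
\<close>

definition component_step :: "nat \<Rightarrow> nat \<Rightarrow> nat \<Rightarrow> nat" where
  "component_step r s q =
    (if p2 (p2 q) = 0 then \<langle>p1 q, \<langle>p1 (p2 q), Suc (Run (p1 r) (cons \<langle>r, s\<rangle> 0) 0)\<rangle>\<rangle>
     else if halted (p2 (p2 q) - 1) then
       if p1 (p2 (p2 (p2 q) - 1)) = 0 then \<langle>p1 q, \<langle>p1 (p2 q) - 1, 0\<rangle>\<rangle>
       else \<langle>p1 q - 1, \<langle>p1 (p2 q), 0\<rangle>\<rangle>
     else \<langle>p1 q, \<langle>p1 (p2 q), Suc (step (p2 (p2 q) - 1))\<rangle>\<rangle>)"

primrec component :: "nat \<Rightarrow> nat \<Rightarrow> nat" where
  "component r 0 = \<langle>p1 (p2 r), \<langle>p1 (p2 (p2 r)), 0\<rangle>\<rangle>"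
| "component r (Suc s) = component_step r s (component r s)"

definition wanted0 :: "nat \<Rightarrow> nat \<Rightarrow> nat" where "wanted0 r s = p1 (component r s)"

definition wanted1 :: "nat \<Rightarrow> nat \<Rightarrow> nat" where "wanted1 r s = p1 (p2 (component r s))"

definition machine :: "nat \<Rightarrow> nat \<Rightarrow> nat" where "machine r s = p2 (p2 (component r s))"

lemmas component_defs = wanted0_def wanted1_def machine_def component_step_def

lemma component_request:
  assumes "machine r s = 0"
  shows "wanted0 r (Suc s) = wanted0 r s" and "wanted1 r (Suc s) = wanted1 r s"
    and "machine r (Suc s) = Suc (Run (p1 r) (cons \<langle>r, s\<rangle> 0) 0)"
  using assms by (simp_all add: component_defs)

lemma component_wait:
  assumes "machine r s = Suc m" and "\<not> halted m"
  shows "wanted0 r (Suc s) = wanted0 r s" and "wanted1 r (Suc s) = wanted1 r s"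
    and "machine r (Suc s) = Suc (step m)"
  using assms by (simp_all add: component_defs)

lemma component_answer:
  assumes "machine r s = Suc m" and "halted m"
  shows "wanted0 r (Suc s) = wanted0 r s - (if p1 (p2 m) = 0 then 0 else 1)"
    and "wanted1 r (Suc s) = wanted1 r s - (if p1 (p2 m) = 0 then 1 else 0)"
    and "machine r (Suc s) = 0"
  using assms by (simp_all add: component_defs)

section \<open>Finiteness of the cliques\<close>

lemma wanted_antimono:
  assumes "s \<le> t"
  shows "wanted0 r t \<le> wanted0 r s" and "wanted1 r t \<le> wanted1 r s"
proof -
  have "wanted0 r (Suc s) \<le> wanted0 r s \<and> wanted1 r (Suc s) \<le> wanted1 r s" for s
    by (simp add: component_defs)
  then show "wanted0 r t \<le> wanted0 r s" and "wanted1 r t \<le> wanted1 r s"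
    using lift_Suc_antimono_le[of "wanted0 r" s t] lift_Suc_antimono_le[of "wanted1 r" s t] assms by blast+
qed

text \<open>Component \<open>r\<close> gets the vertex \<open>\<langle>r, s\<rangle>\<close> at such
  a stage \<open>s\<close>. Naming a vertex by its stage makes membership decidable by running
  \<open>s\<close> stages. The process itself continues when a quota is exhausted; this condition
  ends the clique.\<close>

definition active :: "nat \<Rightarrow> nat \<Rightarrow> bool" where
  "active r s \<longleftrightarrow> machine r s = 0 \<and> wanted0 r s \<noteq> 0 \<and> wanted1 r s \<noteq> 0"

text \<open>Once the least value is attained, no further drop is possible.\<close>

lemma finite_strict_decreases:
  fixes f :: "nat \<Rightarrow> nat"
  assumes "\<And>s. f (Suc s) \<le> f s"
  shows "finite {s. f (Suc s) < f s}"
proof -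
  obtain s where s: "\<And>t. f s \<le> f t"
    using ex_has_least_nat[of "\<lambda>_. True" _ f] by blast
  have "t < s" if "f (Suc t) < f t" for t
  proof (rule ccontr)
    assume "\<not> t < s"
    then have "f t \<le> f s" using lift_Suc_antimono_le[of f, OF assms] by simp
    with s[of "Suc t"] that show False by simp
  qed
  then show ?thesis by (auto intro: finite_subset[OF _ finite_lessThan[of s]])
qed

text \<open>The potential drops at every active stage.\<close>

lemma finite_active: "finite {s. active r s}"
proof -
  \<comment> \<open>A request loses the summand 1. An answer regains it but lowers one quota, and
    the factor 2 outweighs this. The value 0 after a quota is exhausted is never left again.\<close>
  define f where "f s = (if wanted0 r s = 0 \<or> wanted1 r s = 0 then 0
    else 2 * (wanted0 r s + wanted1 r s) + (if machine r s = 0 then 1 else 0))" for s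
  have "f (Suc s) \<le> f s \<and> (active r s \<longrightarrow> f (Suc s) < f s)" for s
  proof (cases "machine r s")
    case 0
    then show ?thesis by (auto simp: f_def active_def component_request)
  next
    case (Suc m)
    show ?thesis
    proof (cases "halted m")
      case True
      show ?thesis using Suc component_answer[OF Suc True]
        by (auto simp: f_def active_def)
    next
      case False
      show ?thesis using Suc component_wait[OF Suc False]
        by (auto simp: f_def active_def)
    qed
  qed
  then have "finite {s. f (Suc s) < f s}" and "{s. active r s} \<subseteq> {s. f (Suc s) < f s}"
    using finite_strict_decreases[of f] by blast+
  then show ?thesis using finite_subset by blast
qed

section \<open>Counting the answers of a halting program\<close>

lemma steps_halt:
  assumes "s \<leadsto> Ret y 0"
  obtains n where "(step ^^ n) s = Ret y 0" and "\<And>i. i < n \<Longrightarrow> \<not> halted ((step ^^ i) s)"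
proof -
  from assms have "\<exists>n. (step ^^ n) s = Ret y 0 \<and> (\<forall>i<n. \<not> halted ((step ^^ i) s))"
  proof (induction rule: converse_rtranclp_induct)
    case base
    show ?case by (rule exI[of _ 0]) simp
  next
    case (step s t)
    then obtain n where n: "(step ^^ n) (step s) = Ret y 0"
      "\<forall>i<n. \<not> halted ((step ^^ i) (step s))" by blast
    show ?case
    proof (cases "halted s")
      case True
      \<comment> \<open>A halted state is a fixed point, so the witness for its successor serves
        again.\<close>
      then have "step s = s" by (simp add: halted_def step_def)
      with n show ?thesis by auto
    next
      case False
      have "\<forall>i<Suc n. \<not> halted ((step ^^ i) s)"
        using n(2) False by (auto simp: less_Suc_eq_0_disj funpow_Suc_right simp del: funpow.simps)
      with n(1) show ?thesis
        by (intro exI[of _ "Suc n"]) (simp add: funpow_Suc_right del: funpow.simps)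
    qed
  qed
  with that show thesis by blast
qed

text \<open>One round: a request at stage \<open>s\<close>, then \<open>n\<close> machine steps, the
  answer read at stage \<open>Suc s + n\<close>, and the next request one stage later. In between
  the machine is running, so no vertex is added.\<close>

lemma component_next_request:
  assumes "machine r s = 0" and "Run (p1 r) (cons \<langle>r, s\<rangle> 0) 0 \<leadsto> Ret (if Q then 1 else 0) 0"
  obtains s' where "s < s'" and "machine r s' = 0" and "\<And>t. s < t \<Longrightarrow> t < s' \<Longrightarrow> \<not> active r t"
    and "wanted0 r s' = wanted0 r s - (if Q then 1 else 0)"
    and "wanted1 r s' = wanted1 r s - (if Q then 0 else 1)"
proof -
  let ?y = "if Q then 1 else 0 :: nat"
  let ?m = "Run (p1 r) (cons \<langle>r, s\<rangle> 0) 0"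
  obtain n where n: "(step ^^ n) ?m = Ret ?y 0" "\<And>i. i < n \<Longrightarrow> \<not> halted ((step ^^ i) ?m)"
    using steps_halt[OF assms(2)] by blast
  have run: "machine r (Suc s + i) = Suc ((step ^^ i) ?m) \<and>
      wanted0 r (Suc s + i) = wanted0 r s \<and> wanted1 r (Suc s + i) = wanted1 r s"
    if "i \<le> n" for i
    using that
  proof (induction i)
    case 0
    show ?case using component_request[OF assms(1)] by simp
  next
    case (Suc i)
    then have "machine r (Suc s + i) = Suc ((step ^^ i) ?m)" by simp
    from component_wait[OF this n(2)] Suc show ?case by simp
  qed
  have "halted (Ret ?y 0)" and "p1 (p2 (Ret ?y 0)) = ?y" by (simp_all add: halted_def Ret_def)
  with run[of n] n(1) component_answer[of r "Suc s + n" "Ret ?y 0"]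
  have "machine r (Suc (Suc s + n)) = 0"
    and "wanted0 r (Suc (Suc s + n)) = wanted0 r s - (if Q then 1 else 0)"
    and "wanted1 r (Suc (Suc s + n)) = wanted1 r s - (if Q then 0 else 1)"
    by simp_all
  moreover have "\<not> active r t" if "s < t" "t < Suc (Suc s + n)" for t
    using run[of "t - Suc s"] that by (simp add: active_def)
  ultimately show thesis using that[of "Suc (Suc s + n)"] by simp
qed

lemma card_active_split:
  assumes "active r s" and "s < s'" and "\<And>t. s < t \<Longrightarrow> t < s' \<Longrightarrow> \<not> active r t"
  shows "card {t. s \<le> t \<and> active r t \<and> P t}
    = (if P s then 1 else 0) + card {t. s' \<le> t \<and> active r t \<and> P t}"
proof -
  have fin: "finite {t. s' \<le> t \<and> active r t \<and> P t}"
    using finite_active[of r] by (rule rev_finite_subset) auto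
  have "{t. s \<le> t \<and> active r t \<and> P t}
      = (if P s then {s} else {}) \<union> {t. s' \<le> t \<and> active r t \<and> P t}"
    using assms by (auto simp: not_less) (metis le_neq_implies_less linorder_not_less)+
  then show ?thesis using assms(2) fin by (auto simp: card_insert_if)
qed

text \<open>Induction on the sum of the quotas, comparing them with the vertices still to come. A
  round started at an active stage lowers just the quota matching the new vertex; once a quota is 0,
  no vertex follows, and the count for that quota is 0 too.\<close>

lemma component_counts:
  assumes total: "\<And>t. Run (p1 r) (cons \<langle>r, t\<rangle> 0) 0 \<leadsto> Ret (if P t then 1 else 0) 0"
    and "machine r s = 0"
  shows "card {t. s \<le> t \<and> active r t \<and> P t} = wanted0 r s \<or>
    card {t. s \<le> t \<and> active r t \<and> \<not> P t} = wanted1 r s"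
  using assms(2)
proof (induction "wanted0 r s + wanted1 r s" arbitrary: s rule: less_induct)
  case less
  obtain s' where s': "s < s'" "machine r s' = 0" "\<And>t. s < t \<Longrightarrow> t < s' \<Longrightarrow> \<not> active r t"
    "wanted0 r s' = wanted0 r s - (if P s then 1 else 0)"
    "wanted1 r s' = wanted1 r s - (if P s then 0 else 1)"
    using component_next_request[OF less.prems total] by blast
  show ?case
  proof (cases "active r s")
    case True
    note split = card_active_split[OF True s'(1,3)]
    have "wanted0 r s' + wanted1 r s' < wanted0 r s + wanted1 r s"
      using True s'(4,5) by (auto simp: active_def)
    from less.hyps[OF this s'(2)] show ?thesis
      using True s'(4,5) split[of P] split[of "\<lambda>t. \<not> P t"] by (auto simp: active_def)
  next
    case False
    \<comment> \<open>A request stage can only be inactive through an exhausted quota, and quotas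
      never grow again.\<close>
    then have "wanted0 r s = 0 \<or> wanted1 r s = 0" using less.prems by (simp add: active_def)
    moreover have "\<not> active r t" if "s \<le> t" for t
      using calculation wanted_antimono[OF that, of r] by (auto simp: active_def)
    then have "card {t. s \<le> t \<and> active r t \<and> Q t} = 0" for Q
      by (metis (no_types, lifting) card.empty empty_Collect_eq)
    ultimately show ?thesis by metis
  qed
qed

section \<open>Computability of the graph\<close>

lemma recursive_component:
  "recursive n R \<Longrightarrow> recursive n S \<Longrightarrow> recursive n (\<lambda>xs. component (R xs) (S xs))"
\<comment> \<open>The stage comes first because it is the recursion variable.\<close>
proof (rule recursive_subst2[where g = "\<lambda>s r. component r s"])
  have "recursive 1 (\<lambda>xs. \<langle>p1 (p2 (xs ! 0)), \<langle>p1 (p2 (p2 (xs ! 0))), 0\<rangle>\<rangle>)"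
    by (intro recursive_intros) simp_all
  moreover have "recursive (Suc (Suc 1)) (\<lambda>xs. component_step (xs ! 2) (xs ! 0) (xs ! 1))"
    unfolding component_step_def halted_def
    by (intro recursive_machine_intros recursive_step recursive_add) simp_all
  ultimately have "recursive (Suc 1) (\<lambda>xs. component (xs ! 1) (xs ! 0))"
    by (rule recursive_primrec) simp_all
  then show "recursive 2 (\<lambda>xs. component (xs ! 1) (xs ! 0))"
    by (simp add: numeral_2_eq_2)
qed

definition G_verts :: "nat set" where "G_verts = {v. active (p1 v) (p2 v)}"

text \<open>Phrased as a case distinction so that it nests with \<open>recursive_if_eq\<close> when
  edges are decided.\<close>

lemma recursive_G_verts:
  assumes "recursive n V" and "recursive n A" and "recursive n B"
  shows "recursive n (\<lambda>xs. if V xs \<in> G_verts then A xs else B xs)"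
proof -
  have "recursive n (\<lambda>xs. if machine (p1 (V xs)) (p2 (V xs)) = 0 then
      if wanted0 (p1 (V xs)) (p2 (V xs)) = 0 then B xs
      else if wanted1 (p1 (V xs)) (p2 (V xs)) = 0 then B xs else A xs
    else B xs)"
    unfolding wanted0_def wanted1_def machine_def
    by (intro recursive_intros recursive_component assms)
  then show ?thesis
    by (rule recursive_cong) (simp add: G_verts_def active_def)
qed

lemma computable_set_G_verts: "computable_set G_verts"
  by (intro computable_setI recursive_G_verts recursive_intros) simp_all

lemma computable_graph_G: "computable_graph (clique_graph p1 G_verts)"
proof -
  have "recursive 2 (\<lambda>xs. if xs ! 0 \<in> G_verts then
      if xs ! 1 \<in> G_verts then if p1 (xs ! 0) = p1 (xs ! 1) then
        if xs ! 0 = xs ! 1 then 0 else 1 else 0 else 0 else 0)"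
    by (intro recursive_G_verts recursive_intros) simp_all
  then have "computable_rel (edges (clique_graph p1 G_verts))"
    by (intro computable_relI, elim recursive_cong) (auto simp: clique_graph_def)
  then show ?thesis
    using computable_set_G_verts
    by (simp add: computable_graph_def is_graph_clique_graph) (simp add: clique_graph_def)
qed

section \<open>Cliques inside a computable partition\<close>

lemma clique_G_verts:
  assumes "X \<subseteq> G_verts"
  shows "clique p1 X r = (\<lambda>t. \<langle>r, t\<rangle>) ` {t. active r t \<and> \<langle>r, t\<rangle> \<in> X}"
proof -
  have "v \<in> (\<lambda>t. \<langle>r, t\<rangle>) ` {t. active r t \<and> \<langle>r, t\<rangle> \<in> X}" if "v \<in> X" "p1 v = r" for v
    using that assms pair_p1_p2[of v] by (intro image_eqI[of _ _ "p2 v"]) (auto simp: G_verts_def)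
  then show ?thesis by auto
qed

lemma card_clique_G_verts:
  assumes "X \<subseteq> G_verts"
  shows "card (clique p1 X r) = card {t. active r t \<and> \<langle>r, t\<rangle> \<in> X}"
  unfolding clique_G_verts[OF assms] by (rule card_image) (auto simp: inj_on_def)

lemma finite_clique_G_verts:
  assumes "X \<subseteq> G_verts"
  shows "finite (clique p1 X r)"
  unfolding clique_G_verts[OF assms]
  using finite_active[of r] by (intro finite_imageI) (rule rev_finite_subset, auto)

text \<open>Component \<open>r\<close> starts with quotas \<open>a\<close> and \<open>b\<close> and
  runs the code of \<open>f\<close>, which answers on every vertex; so
  \<open>component_counts\<close> applies from stage 0. The number \<open>k\<close> is mere padding
  that provides infinitely many such components.\<close>

lemma card_clique_partition:
  assumes f: "\<And>x. rec_eval f [x] (if x \<in> X0 then 1 else 0)"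
    and X: "X0 \<union> X1 = G_verts" "X0 \<inter> X1 = {}"
    and r: "r = \<langle>code f, \<langle>a, \<langle>b, k\<rangle>\<rangle>\<rangle>"
  shows "card (clique p1 X0 r) = a \<or> card (clique p1 X1 r) = b"
proof -
  have "Run (p1 r) (cons \<langle>r, t\<rangle> 0) 0 \<leadsto> Ret (if \<langle>r, t\<rangle> \<in> X0 then 1 else 0) 0" for t
    using steps_complete[OF f[of "\<langle>r, t\<rangle>"], of 0] by (simp add: r)
  moreover have "machine r 0 = 0" and "wanted0 r 0 = a" and "wanted1 r 0 = b"
    by (simp_all add: r wanted0_def wanted1_def machine_def)
  moreover have "active r t \<and> \<langle>r, t\<rangle> \<notin> X0 \<longleftrightarrow> active r t \<and> \<langle>r, t\<rangle> \<in> X1" for t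
    using X unfolding G_verts_def by auto
  moreover have "X0 \<subseteq> G_verts" "X1 \<subseteq> G_verts" using X by auto
  ultimately show ?thesis
    using component_counts[of r "\<lambda>t. \<langle>r, t\<rangle> \<in> X0" 0] by (simp add: card_clique_G_verts)
qed

lemma computable_partition:
  assumes "computable_set X0" and X: "X0 \<union> X1 = G_verts" "X0 \<inter> X1 = {}"
  shows "isomorphic (clique_graph p1 X0) K_inf_fin \<or> isomorphic (clique_graph p1 X1) K_inf_fin"
proof (rule ccontr)
  assume no: "\<not> ?thesis"
  have sub: "X0 \<subseteq> G_verts" "X1 \<subseteq> G_verts" using X by auto
  obtain f where f: "\<And>x. rec_eval f [x] (if x \<in> X0 then 1 else 0)"
    using assms(1) unfolding computable_set_def by blast
  \<comment> \<open>All cliques are finite, so by \<open>isomorphic_K_inf_fin\<close> a failure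
    means that some size occurs only finitely often.\<close>
  obtain a where a: "finite {r. card (clique p1 X0 r) = a}"
    using no isomorphic_K_inf_fin[OF finite_clique_G_verts[OF sub(1)]] by blast
  obtain b where b: "finite {r. card (clique p1 X1 r) = b}"
    using no isomorphic_K_inf_fin[OF finite_clique_G_verts[OF sub(2)]] by blast
  \<comment> \<open>Pigeonhole: infinitely many labels, one for each \<open>k\<close>, would lie in
    a union of two finite sets.\<close>
  have "range (\<lambda>k. \<langle>code f, \<langle>a, \<langle>b, k\<rangle>\<rangle>\<rangle>)
      \<subseteq> {r. card (clique p1 X0 r) = a} \<union> {r. card (clique p1 X1 r) = b}"
    using card_clique_partition[OF f X refl] by auto
  moreover have "infinite (range (\<lambda>k. \<langle>code f, \<langle>a, \<langle>b, k\<rangle>\<rangle>\<rangle>))"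
    by (rule range_inj_infinite) (auto simp: inj_def)
  ultimately show False using a b finite_subset by blast
qed

text \<open>Excludes the empty side when \<open>computable_partition\<close> is applied to the whole
  vertex set and \<open>{}\<close>.\<close>

lemma not_isomorphic_empty: "\<not> isomorphic (clique_graph \<kappa> {}) K_inf_fin"
proof -
  have "((1, 0), 0) \<in> verts K_inf_fin"
    by (simp add: K_inf_fin_def disjoint_union_def complete_graph_def)
  then show ?thesis by (auto simp: isomorphic_def bij_betw_def clique_graph_def)
qed

theorem theorem3p5:
  "\<exists>G :: nat graph. computable_graph G \<and> isomorphic G K_inf_fin \<and>
     (\<forall>X0 X1. computable_set X0 \<and> computable_set X1 \<and>
        X0 \<union> X1 = verts G \<and> X0 \<inter> X1 = {} \<longrightarrow>
          isomorphic (induced_subgraph G X0) K_inf_fin \<or>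
          isomorphic (induced_subgraph G X1) K_inf_fin)"
proof (intro exI[of _ "clique_graph p1 G_verts"] conjI allI impI)
  show "computable_graph (clique_graph p1 G_verts)" by (rule computable_graph_G)
  show "isomorphic (clique_graph p1 G_verts) K_inf_fin"
    using computable_partition[OF computable_set_G_verts, of "{}"] not_isomorphic_empty by auto
next
  fix X0 X1
  assume "computable_set X0 \<and> computable_set X1 \<and>
    X0 \<union> X1 = verts (clique_graph p1 G_verts) \<and> X0 \<inter> X1 = {}"
  then have X: "computable_set X0" "X0 \<union> X1 = G_verts" "X0 \<inter> X1 = {}"
    by (simp_all add: clique_graph_def)
  then have "X0 \<subseteq> G_verts" "X1 \<subseteq> G_verts" by auto
  then show "isomorphic (induced_subgraph (clique_graph p1 G_verts) X0) K_inf_fin \<or>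
      isomorphic (induced_subgraph (clique_graph p1 G_verts) X1) K_inf_fin"
    using computable_partition[OF X] by (simp add: induced_subgraph_clique_graph)
qed

end
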